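(* Let $r\ge1$ and $k$ be integers with $2r+5\le 2k+1\le 3r+1$, and let $C_{2k+1}$ be the cycle on $2k+1$ vertices. Put $q=2k-2r$ (so $2k+1=2r+1+q$), and write $2k+1=lq+m$ where $l\ge 3$ is an integer and $m\in\{0,1,\dots,q-1\}$. Then: (1) if either ($l$ is odd, $m=q-1$ and $2k+1\ge 5q$) or ($l$ is even and $m=1$), then $M_r^I(C_{2k+1})=k+2$; (2) otherwise, $M_r^I(C_{2k+1})=\gcd(q,2k+1)\left\lceil\frac{2k+1}{2\gcd(q,2k+1)}\right\rceil$.
   Context: For a graph $G=(V,E)$ and integer $r\ge1$, $d(x,y)$ is the number of edges in a shortest path between $x$ and $y$, $N_r[x]=\{y\in V: d(x,y)\le r\}$, and for $D\subseteq V$, $D_r(x)=N_r[x]\cap D$. A set $D\subseteq V$ is an $r$-identifying code ($r$-IC) of $G$ if $D_r(x)\neq\emptyset$ for every $x\in V$ and $D_r(x)\neq D_r(y)$ for all distinct $x,y\in V$. $M_r^I(G)$ denotes the minimum cardinality of an $r$-identifying code of $G$. *)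

theory Defs
  imports Complex_Main "HOL-Library.Extended_Nat"
begin

type_synonym 'a graph = "'a set \<times> 'a set set"

abbreviation verts :: "'a graph \<Rightarrow> 'a set" where
  "verts G \<equiv> fst G"

abbreviation edges :: "'a graph \<Rightarrow> 'a set set" where
  "edges G \<equiv> snd G"

definition is_path :: "'a graph \<Rightarrow> 'a list \<Rightarrow> bool" where
  "is_path G p \<longleftrightarrow> p \<noteq> [] \<and> distinct p \<and> set p \<subseteq> verts G \<and>
     (\<forall>i. Suc i < length p \<longrightarrow> {p ! i, p ! Suc i} \<in> edges G)"

(* A path is given by its list of vertices, so it has one edge fewer than its length.
   The distance is infinite if no path exists. *)
definition gdist :: "'a graph \<Rightarrow> 'a \<Rightarrow> 'a \<Rightarrow> enat" where
  "gdist G x y = (INF p \<in> {p. is_path G p \<and> hd p = x \<and> last p = y}. enat (length p - 1))"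

definition nbhd :: "'a graph \<Rightarrow> nat \<Rightarrow> 'a \<Rightarrow> 'a set" where
  "nbhd G r x = {y \<in> verts G. gdist G x y \<le> enat r}"

definition identifying_code :: "'a graph \<Rightarrow> nat \<Rightarrow> 'a set \<Rightarrow> bool" where
  "identifying_code G r D \<longleftrightarrow> D \<subseteq> verts G \<and>
     (\<forall>x \<in> verts G. nbhd G r x \<inter> D \<noteq> {}) \<and>
     (\<forall>x \<in> verts G. \<forall>y \<in> verts G. x \<noteq> y \<longrightarrow> nbhd G r x \<inter> D \<noteq> nbhd G r y \<inter> D)"

(* Infinite if there is no finite identifying code; in particular, an equation with a
   finite value includes the existence of a code. *)
definition min_identifying_code :: "nat \<Rightarrow> 'a graph \<Rightarrow> enat" where
  "min_identifying_code r G =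
     (INF D \<in> {D. finite D \<and> identifying_code G r D}. enat (card D))"

(* This is the cycle on n vertices only for n at least 3. *)
definition cycle_graph :: "nat \<Rightarrow> nat graph" where
  "cycle_graph n = ({..<n}, {{i, Suc i mod n} | i. i < n})"

end

theory Submission
  imports Defs "HOL-Number_Theory.Cong"
begin

text \<open>Put \<open>n = 2 * k + 1\<close>. The complement of a ball of radius \<open>r\<close> is an arc of \<open>q\<close> consecutive
  vertices, so \<open>D\<close> is an identifying code iff it is a vertex cover of the circulant graph with
  edges \<open>{z, z + q}\<close> and misses at most one arc of length \<open>q\<close>. The circulant graph consists of
  \<open>g = gcd q n\<close> odd cycles of length \<open>2 * h + 1 = n div g\<close>, hence a cover has at least
  \<open>g * (h + 1)\<close> vertices. For \<open>g > 1\<close> the minimum covers of the cycles can be chosen so that no arc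
  is missed. For \<open>g = 1\<close> the minimum cover is unique up to rotation, and it misses two arcs iff the
  even integer \<open>u\<close> with \<open>u * q\<close> congruent to 1 satisfies \<open>(q - 1) * \<bar>u\<bar> \<le> n - 5\<close>; this forces
  \<open>u * q = 1 + n\<close> or \<open>u * q = 1 - n\<close>, the two exceptional cases, in which one more vertex suffices.\<close>

subsection \<open>Balls and identifying codes in cycles\<close>

lemma is_path_rev:
  assumes "is_path G p"
  shows "is_path G (rev p)"
proof -
  have "{rev p ! i, rev p ! Suc i} \<in> edges G" if "Suc i < length p" for i
  proof -
    let ?j = "length p - Suc (Suc i)"
    have "{p ! ?j, p ! Suc ?j} \<in> edges G"
      using assms that unfolding is_path_def by auto
    moreover have "rev p ! i = p ! Suc ?j" "rev p ! Suc i = p ! ?j"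
      using that by (auto simp: rev_nth Suc_diff_Suc)
    ultimately show ?thesis
      by (simp add: insert_commute)
  qed
  then show ?thesis
    using assms unfolding is_path_def by auto
qed

lemma gdist_commute_le: "gdist G x y \<le> gdist G y x"
  unfolding gdist_def
proof (rule INF_greatest)
  fix p assume "p \<in> {p. is_path G p \<and> hd p = y \<and> last p = x}"
  then have "is_path G (rev p)" "hd (rev p) = x" "last (rev p) = y"
    by (auto simp: is_path_rev hd_rev last_rev)
  then have "(INF p\<in>{p. is_path G p \<and> hd p = x \<and> last p = y}. enat (length p - 1))
               \<le> enat (length (rev p) - 1)"
    by (intro INF_lower) simp
  then show "(INF p\<in>{p. is_path G p \<and> hd p = x \<and> last p = y}. enat (length p - 1))
               \<le> enat (length p - 1)"
    by simp
qed

lemma gdist_commute: "gdist G x y = gdist G y x"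
  by (simp add: antisym gdist_commute_le)

text \<open>Path lengths are naturals: if every path had more than \<open>r\<close> edges, the
  infimum would be at least \<open>r + 1\<close>.\<close>

lemma gdist_le_enatD:
  assumes "gdist G x y \<le> enat r"
  obtains p where "is_path G p" "hd p = x" "last p = y" "length p \<le> Suc r"
proof -
  have "\<exists>p. is_path G p \<and> hd p = x \<and> last p = y \<and> length p \<le> Suc r"
  proof (rule ccontr)
    assume "\<not> ?thesis"
    then have "enat (Suc r) \<le> gdist G x y"
      unfolding gdist_def by (intro INF_greatest) force
    with assms have "enat (Suc r) \<le> enat r"
      by (rule order_trans[rotated])
    then show False
      by simp
  qed
  then show thesis
    using that by blast
qed

lemma gdist_cycle_le:
  assumes "0 < n" "x < n" "d < n"
  shows "gdist (cycle_graph n) x ((x + d) mod n) \<le> enat d"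
proof -
  define p where "p = map (\<lambda>i. (x + i) mod n) [0..<Suc d]"
  have "inj_on (\<lambda>i. (x + i) mod n) {0..<Suc d}"
  proof (rule inj_onI)
    fix i j assume "i \<in> {0..<Suc d}" "j \<in> {0..<Suc d}" "(x + i) mod n = (x + j) mod n"
    then have "i mod n = j mod n"
      using cong_add_lcancel_nat[of x i j n] by (simp add: cong_def)
    then show "i = j"
      using \<open>i \<in> _\<close> \<open>j \<in> _\<close> assms by simp
  qed
  then have "distinct p"
    unfolding p_def by (simp only: distinct_map set_upt distinct_upt)
  have "is_path (cycle_graph n) p"
    unfolding is_path_def
  proof (intro conjI allI impI)
    show "p \<noteq> []" by (simp add: p_def)
    show "distinct p" by fact
    show "set p \<subseteq> verts (cycle_graph n)"
      using assms by (auto simp: p_def cycle_graph_def)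
    fix i assume "Suc i < length p"
    then have "p ! i = (x + i) mod n" "p ! Suc i = Suc ((x + i) mod n) mod n"
      by (auto simp: p_def nth_append less_Suc_eq mod_Suc_eq simp del: upt_Suc)
    then show "{p ! i, p ! Suc i} \<in> edges (cycle_graph n)"
      using assms by (auto simp: cycle_graph_def)
  qed
  moreover have "hd p = x"
    using assms by (simp add: p_def hd_map del: upt_Suc)
  moreover have "last p = (x + d) mod n"
    by (simp add: p_def)
  moreover have "length p - 1 = d"
    by (simp add: p_def)
  ultimately show ?thesis
    unfolding gdist_def by (intro INF_lower2[of p]) auto
qed

text \<open>Each edge shifts the position by 1 or -1 modulo \<open>n\<close>; the shifts add up to a
  displacement \<open>s\<close> bounded by the number of edges. This bounds distances from below, as
  \<open>gdist_cycle_le\<close> bounds them from above.\<close>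

lemma path_displacement:
  assumes "p \<noteq> []" "set p \<subseteq> {..<n}"
    and "\<forall>i. Suc i < length p \<longrightarrow> {p ! i, p ! Suc i} \<in> edges (cycle_graph n)"
  shows "\<exists>s. \<bar>s\<bar> \<le> int (length p) - 1 \<and> int (last p) = (int (hd p) + s) mod int n"
  using assms
proof (induction p rule: induct_list012)
  case 1
  then show ?case by simp
next
  case (2 x)
  then show ?case by (auto intro: exI[of _ 0])
next
  case (3 a b ps)
  have "\<forall>i. Suc i < length (b # ps) \<longrightarrow> {(b # ps) ! i, (b # ps) ! Suc i} \<in> edges (cycle_graph n)"
    using 3(5) by force
  then obtain s where s: "\<bar>s\<bar> \<le> int (length (b # ps)) - 1"
      "int (last (b # ps)) = (int b + s) mod int n"
    using 3(2) 3(4) by auto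
  have "{a, b} \<in> edges (cycle_graph n)"
    using 3(5)[rule_format, of 0] by simp
  then obtain i where "i < n" "{a, b} = {i, Suc i mod n}"
    by (auto simp: cycle_graph_def)
  then have "b = Suc a mod n \<or> a = Suc b mod n"
    by (auto simp: doubleton_eq_iff)
  then obtain e where "\<bar>e\<bar> \<le> 1" "int b mod int n = (int a + e) mod int n"
  proof
    assume "b = Suc a mod n"
    then have "int b mod int n = (int a + 1) mod int n"
      by (simp add: zmod_int add.commute)
    then show thesis using that[of 1] by simp
  next
    assume "a = Suc b mod n"
    then have "(int a + - 1) mod int n = ((int b + 1) mod int n + - 1) mod int n"
      by (simp add: zmod_int add.commute)
    also have "\<dots> = int b mod int n"
      by (subst mod_add_left_eq) simp
    finally show thesis using that[of "-1"] by simp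
  qed
  moreover have "(int b + s) mod int n = ((int b mod int n) + s) mod int n"
    by (simp add: mod_add_left_eq)
  ultimately have "int (last (b # ps)) = (int a + (e + s)) mod int n"
    using s(2) by (simp add: mod_add_left_eq add.assoc)
  moreover have "\<bar>e + s\<bar> \<le> int (length (a # b # ps)) - 1"
    using s(1) \<open>\<bar>e\<bar> \<le> 1\<close> by auto
  ultimately show ?case by auto
qed

text \<open>The complement of the ball around \<open>x\<close> is the arc of length \<open>q\<close> that starts at
  \<open>x + r + 1\<close>.\<close>

lemma mem_nbhd_cycle_iff:
  assumes n: "n = 2 * r + 1 + q" and x: "x < n"
  shows "y \<in> nbhd (cycle_graph n) r x \<longleftrightarrow>
           y < n \<and> int q \<le> (int y - (int x + int r + 1)) mod int n"
proof (intro iffI conjI)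
  assume y: "y \<in> nbhd (cycle_graph n) r x"
  then show "y < n"
    by (simp add: nbhd_def cycle_graph_def)
  from y obtain p where p: "is_path (cycle_graph n) p" "hd p = x" "last p = y" "length p \<le> Suc r"
    unfolding nbhd_def by (auto elim: gdist_le_enatD)
  then obtain s where s: "\<bar>s\<bar> \<le> int (length p) - 1" "int y = (int x + s) mod int n"
    using path_displacement[of p n] unfolding is_path_def by (auto simp: cycle_graph_def)
  have "(int y - (int x + int r + 1)) mod int n = (s - int r - 1) mod int n"
    unfolding s(2) by (subst mod_diff_left_eq) (simp add: algebra_simps)
  also have "\<dots> = (s - int r - 1 + int n) mod int n"
    by simp
  also have "\<dots> = s - int r - 1 + int n"
    using s(1) p(4) n by (intro mod_pos_pos_trivial) auto
  finally show "int q \<le> (int y - (int x + int r + 1)) mod int n"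
    using s(1) p(4) n by simp
next
  assume y: "y < n \<and> int q \<le> (int y - (int x + int r + 1)) mod int n"
  \<comment> \<open>\<open>s\<close> is the signed representative of \<open>y - x\<close> modulo
    \<open>n\<close>: the residue lies between \<open>q\<close> and \<open>n - 1\<close>, so
    subtracting \<open>r + q = n - r - 1\<close> puts \<open>s\<close> between \<open>-r\<close> and
    \<open>r\<close>. Its sign decides whether the short path runs forward from \<open>x\<close> or
    from \<open>y\<close>.\<close>
  define s where "s = (int y - (int x + int r + 1)) mod int n + int r + 1 - int n"
  have "(int y - (int x + int r + 1)) mod int n < int n"
    using n by simp
  then have s: "- int r \<le> s" "s \<le> int r"
    using conjunct2[OF y] n unfolding s_def by linarith+
  have "(int x + s) mod int n =
          ((int y - (int x + int r + 1)) mod int n + (int x + int r + 1 - int n)) mod int n"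
    by (simp add: s_def algebra_simps)
  also have "\<dots> = int y"
    using y by (subst mod_add_left_eq) simp
  finally have eq: "int y = (int x + s) mod int n" ..
  have "gdist (cycle_graph n) x y \<le> enat r"
  proof (cases "0 \<le> s")
    case True
    then have "int y = int ((x + nat s) mod n)"
      using eq by (simp add: zmod_int)
    then have "y = (x + nat s) mod n"
      by simp
    then have "gdist (cycle_graph n) x y \<le> enat (nat s)"
      using gdist_cycle_le[of n x "nat s"] s n x by auto
    also have "\<dots> \<le> enat r" using s by simp
    finally show ?thesis .
  next
    case False
    have "(int y + - s) mod int n = int x mod int n"
      unfolding eq by (subst mod_add_left_eq) simp
    then have "int x = int ((y + nat (- s)) mod n)"
      using x False by (simp add: zmod_int)
    then have "x = (y + nat (- s)) mod n"
      by simp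
    then have "gdist (cycle_graph n) y x \<le> enat (nat (- s))"
      using gdist_cycle_le[of n y "nat (- s)"] s n y by auto
    also have "\<dots> \<le> enat r" using s by simp
    finally show ?thesis by (simp add: gdist_commute)
  qed
  then show "y \<in> nbhd (cycle_graph n) r x"
    using y by (simp add: nbhd_def cycle_graph_def)
qed

section \<open>Identifying codes as covers that miss at most one arc\<close>

text \<open>Positions are integers read modulo \<open>n\<close>, so that shifts and multiples of
  \<open>q\<close>, negative ones included, need no explicit wrap-around.\<close>

definition mem_mod :: "nat \<Rightarrow> nat set \<Rightarrow> int \<Rightarrow> bool" where
  "mem_mod n D z \<longleftrightarrow> nat (z mod int n) \<in> D"

lemma mem_mod_cong: "[z = w] (mod int n) \<Longrightarrow> mem_mod n D z = mem_mod n D w"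
  by (simp add: mem_mod_def cong_def)

text \<open>The complements of two consecutive balls are the arcs of length \<open>q\<close>
  starting at \<open>z\<close> and \<open>z + 1\<close>; they differ only in \<open>z\<close> and
  \<open>z + q\<close>, so one of these is in the code. In general a vertex that separates two balls
  lies in the complement of one of them.\<close>

lemma identifying_code_cycleD:
  assumes n: "n = 2 * r + 1 + q" and q: "1 \<le> q" "2 * q < n" and code: "identifying_code (cycle_graph n) r D"
  shows "D \<subseteq> {..<n}"
    and "mem_mod n D z \<or> mem_mod n D (z + int q)"
    and "\<not> [z = w] (mod int n) \<Longrightarrow>
           \<exists>t\<in>{0..<int q}. mem_mod n D (z + t) \<or> mem_mod n D (w + t)"
proof -
  show D: "D \<subseteq> {..<n}"
    using code by (simp add: identifying_code_def cycle_graph_def)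
  \<comment> \<open>The ball around \<open>X z\<close> has the arc from \<open>z\<close> to
    \<open>z + q - 1\<close> as its complement.\<close>
  define X where "X z = nat ((z - int r - 1) mod int n)" for z
  have X: "X z < n" for z
    using n by (simp add: X_def nat_less_iff)
  have nbhd_X: "nbhd (cycle_graph n) r (X z) \<inter> D =
                  {y \<in> D. int q \<le> (int y - z) mod int n}" for z
  proof -
    have "(int y - (int (X z) + int r + 1)) mod int n = (int y - z) mod int n" for y
    proof -
      have "(int y - (int (X z) + int r + 1)) = (int y - int r - 1) - (z - int r - 1) mod int n"
        using n by (simp add: X_def)
      then show ?thesis
        by (simp only: mod_diff_right_eq) (simp add: algebra_simps)
    qed
    then show ?thesis
      using D by (auto simp: mem_nbhd_cycle_iff[OF n X])
  qed
  have differ: "\<exists>y\<in>D. (int q \<le> (int y - z) mod int n) \<noteq> (int q \<le> (int y - w) mod int n)"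
    if zw: "\<not> [z = w] (mod int n)" for z w
  proof -
    have "X z \<noteq> X w"
    proof
      assume "X z = X w"
      then have "[z - int r - 1 = w - int r - 1] (mod int n)"
        using n by (simp add: X_def cong_def eq_nat_nat_iff)
      then have "[z - int r - 1 + (int r + 1) = w - int r - 1 + (int r + 1)] (mod int n)"
        by (intro cong_add cong_refl)
      then show False using zw by simp
    qed
    then have "nbhd (cycle_graph n) r (X z) \<inter> D \<noteq> nbhd (cycle_graph n) r (X w) \<inter> D"
      using code X unfolding identifying_code_def by (auto simp: cycle_graph_def)
    then show ?thesis
      unfolding nbhd_X by blast
  qed
  have mem: "mem_mod n D (z + (int y - z) mod int n)" if "y \<in> D" for y z
    using that D by (auto simp: mem_mod_def mod_add_right_eq)
  show "mem_mod n D z \<or> mem_mod n D (z + int q)"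
  proof -
    have "\<not> [z = z + 1] (mod int n)"
    proof
      assume "[z = z + 1] (mod int n)"
      then have "int n dvd z - (z + 1)"
        by (simp only: cong_iff_dvd_diff)
      then have "int n dvd 1" by simp
      then show False using n q by simp
    qed
    then obtain y where y: "y \<in> D"
        "(int q \<le> (int y - z) mod int n) \<noteq> (int q \<le> (int y - (z + 1)) mod int n)"
      using differ by blast
    define a where "a = (int y - z) mod int n"
    have a: "0 \<le> a" "a < int n" using n by (auto simp: a_def)
    have "(int y - (z + 1)) mod int n = (a - 1) mod int n"
      unfolding a_def by (subst mod_diff_left_eq) (simp add: algebra_simps)
    also have "\<dots> = (if a = 0 then int n - 1 else a - 1)"
      using a by (auto simp: zmod_minus1)
    \<comment> \<open>Moving the start from \<open>z\<close> to \<open>z + 1\<close> lowers the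
      offset \<open>a\<close> by one, or wraps 0 to \<open>n - 1\<close>; only at 0 and at
      \<open>q\<close> does this cross the threshold \<open>q\<close>.\<close>
    finally have "a = 0 \<or> a = int q"
      using y(2) a q unfolding a_def[symmetric] by (auto split: if_splits)
    then show ?thesis
      using mem[OF y(1), of z] unfolding a_def[symmetric] by auto
  qed
  show "\<exists>t\<in>{0..<int q}. mem_mod n D (z + t) \<or> mem_mod n D (w + t)"
    if zw: "\<not> [z = w] (mod int n)"
  proof -
    obtain y where y: "y \<in> D"
        "(int q \<le> (int y - z) mod int n) \<noteq> (int q \<le> (int y - w) mod int n)"
      using differ[OF zw] by blast
    then consider "(int y - z) mod int n < int q" | "(int y - w) mod int n < int q"
      by linarith
    then show ?thesis
    proof cases
      case 1
      then show ?thesis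
        using mem[OF y(1), of z] n by (intro bexI[of _ "(int y - z) mod int n"]) auto
    next
      case 2
      then show ?thesis
        using mem[OF y(1), of w] n by (intro bexI[of _ "(int y - w) mod int n"]) auto
    qed
  qed
qed

text \<open>Each ball contains a pair \<open>z\<close>, \<open>z + q\<close>, so the cover meets it.
  Centres at cyclic distance at most \<open>q\<close> are separated by such a pair; for farther ones
  the complements are disjoint arcs, and a code vertex in either arc separates the balls.\<close>

lemma identifying_code_cycleI:
  assumes n: "n = 2 * r + 1 + q" and q: "1 \<le> q" "2 * q \<le> n" "q \<le> r"
    and D: "D \<subseteq> {..<n}"
    and cover: "\<And>z. mem_mod n D z \<or> mem_mod n D (z + int q)"
    and runs: "\<And>z w. \<not> [z = w] (mod int n) \<Longrightarrow>
           \<exists>t\<in>{0..<int q}. mem_mod n D (z + t) \<or> mem_mod n D (w + t)"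
  shows "identifying_code (cycle_graph n) r D"
proof -
  have nb: "(nat (z mod int n) \<in> nbhd (cycle_graph n) r x) =
              (int q \<le> (z - (int x + int r + 1)) mod int n)" if "x < n" for x z
  proof -
    have "nat (z mod int n) < n"
      using n by (simp add: nat_less_iff)
    moreover have "(int (nat (z mod int n)) - (int x + int r + 1)) mod int n =
        (z - (int x + int r + 1)) mod int n"
      using n by (simp add: mod_diff_left_eq)
    ultimately show ?thesis
      using mem_nbhd_cycle_iff[OF n that] by simp
  qed
  have nonempty: "nbhd (cycle_graph n) r x \<inter> D \<noteq> {}" if x: "x < n" for x
  proof -
    have ball: "nat ((int x - int r + s) mod int n) \<in> nbhd (cycle_graph n) r x"
      if "s = 0 \<or> s = int q" for s
    proof -
      have "(int x - int r + s - (int x + int r + 1)) mod int n = (s + int q - int n) mod int n"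
        using n by (simp add: algebra_simps)
      also have "\<dots> = (s + int q) mod int n"
        by simp
      also have "\<dots> = s + int q"
        using that q n by (intro mod_pos_pos_trivial) auto
      finally show ?thesis
        using nb[OF x] that by auto
    qed
    show ?thesis
      using cover[of "int x - int r"] ball[of 0] ball[of "int q"] unfolding mem_mod_def by auto
  qed
  have near: "nbhd (cycle_graph n) r x \<inter> D \<noteq> nbhd (cycle_graph n) r y \<inter> D"
    if xy: "x < n" "y < n" and d: "0 < (int y - int x) mod int n" "(int y - int x) mod int n \<le> int q"
    for x y
  proof -
    define d where "d = (int y - int x) mod int n"
    \<comment> \<open>\<open>?z\<close> is the first vertex missed by the ball around
      \<open>x\<close>, and \<open>?z + q\<close> is the first one after the missed arc. As
      \<open>y\<close> is at most \<open>q\<close> steps ahead, \<open>?z\<close> lies only in the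
      ball around \<open>y\<close> and \<open>?z + q\<close> only in the ball around
      \<open>x\<close>.\<close>
    let ?z = "int x + int r + 1"
    have z1: "(?z - (int y + int r + 1)) mod int n = int n - d"
    proof -
      have "(?z - (int y + int r + 1)) mod int n = (- (int y - int x)) mod int n"
        by (simp add: algebra_simps)
      then show ?thesis
        using d zmod_zminus1_eq_if[of "int y - int x" "int n"] by (auto simp: d_def)
    qed
    have z2: "(?z + int q - (int y + int r + 1)) mod int n = int q - d"
    proof -
      have "(?z + int q - (int y + int r + 1)) mod int n = (int q - (int y - int x)) mod int n"
        by (simp add: algebra_simps)
      also have "\<dots> = (int q - d) mod int n"
        unfolding d_def by (simp add: mod_diff_right_eq)
      also have "\<dots> = int q - d"
        using d q n unfolding d_def by (intro mod_pos_pos_trivial) auto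
      finally show ?thesis .
    qed
    have 1: "nat (?z mod int n) \<in> nbhd (cycle_graph n) r y"
            "nat (?z mod int n) \<notin> nbhd (cycle_graph n) r x"
      using d q unfolding nb[OF xy(1)] nb[OF xy(2)] z1 z2 by (auto simp: d_def)
    have 2: "nat ((?z + int q) mod int n) \<notin> nbhd (cycle_graph n) r y"
            "nat ((?z + int q) mod int n) \<in> nbhd (cycle_graph n) r x"
      using d q n unfolding nb[OF xy(1)] nb[OF xy(2)] z1 z2 by (auto simp: d_def)
    show ?thesis
      using cover[of ?z] 1 2 unfolding mem_mod_def by blast
  qed
  have far: "nbhd (cycle_graph n) r x \<inter> D \<noteq> nbhd (cycle_graph n) r y \<inter> D"
    if xy: "x < n" "y < n" and d: "int q < (int y - int x) mod int n" "int q < (int x - int y) mod int n"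
    for x y
  proof -
    have neg: "(int x - int y) mod int n = int n - (int y - int x) mod int n"
      using zmod_zminus1_eq_if[of "int y - int x" "int n"] d by (simp split: if_splits)
    \<comment> \<open>A vertex of one missed arc has offset at least \<open>q\<close> from the start
      of the other: the arcs are disjoint.\<close>
    have out: "int q \<le> (t - c) mod int n"
      if "0 \<le> t" "t < int q" "int q < c mod int n" "c mod int n < int n - int q" for t c
    proof -
      have "(t - c) mod int n = (t - c mod int n + int n) mod int n"
        by (simp add: mod_diff_right_eq)
      also have "\<dots> = t - c mod int n + int n"
        using that by (intro mod_pos_pos_trivial) auto
      finally show ?thesis using that by linarith
    qed
    have "\<not> [int x + int r + 1 = int y + int r + 1] (mod int n)"
    proof
      assume "[int x + int r + 1 = int y + int r + 1] (mod int n)"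
      then have "int n dvd (int y - int x)"
        by (simp add: cong_iff_dvd_diff dvd_diff_commute)
      then show False using d by auto
    qed
    then obtain t where t: "0 \<le> t" "t < int q"
        "mem_mod n D (int x + int r + 1 + t) \<or> mem_mod n D (int y + int r + 1 + t)"
      using runs by (metis atLeastLessThan_iff)
    have tm: "t mod int n = t"
      using t q n by (intro mod_pos_pos_trivial) auto
    have s: "int x + int r + 1 + t - (int y + int r + 1) = t - (int y - int x)"
            "int y + int r + 1 + t - (int x + int r + 1) = t - (int x - int y)"
            "int y + int r + 1 + t - (int y + int r + 1) = t"
            "int x + int r + 1 + t - (int x + int r + 1) = t"
      by auto
    have 1: "nat ((int x + int r + 1 + t) mod int n) \<in> nbhd (cycle_graph n) r y"
            "nat ((int x + int r + 1 + t) mod int n) \<notin> nbhd (cycle_graph n) r x"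
            "nat ((int y + int r + 1 + t) mod int n) \<notin> nbhd (cycle_graph n) r y"
            "nat ((int y + int r + 1 + t) mod int n) \<in> nbhd (cycle_graph n) r x"
      using out[of t "int y - int x"] out[of t "int x - int y"] t d neg
      unfolding nb[OF xy(1)] nb[OF xy(2)] s tm by auto
    show ?thesis
      using t(3) 1 unfolding mem_mod_def by blast
  qed
  have "nbhd (cycle_graph n) r x \<inter> D \<noteq> nbhd (cycle_graph n) r y \<inter> D"
    if xy: "x < n" "y < n" "x \<noteq> y" for x y
  proof -
    have pos: "0 < (int y - int x) mod int n" if "x < n" "y < n" "x \<noteq> y" for x y
    proof -
      have "(int y - int x) mod int n \<noteq> 0"
        using that zdvd_imp_le[of "int n" "int y - int x"] zdvd_imp_le[of "int n" "int x - int y"]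
        by (metis dvd_eq_mod_eq_0 mod_eq_dvd_iff mod_less nat_int zmod_int)
      then show ?thesis using that pos_mod_sign[of "int n" "int y - int x"] by linarith
    qed
    show ?thesis
      using near[of x y] near[of y x] far[of x y] pos[of x y] pos[of y x] xy
      by (metis linorder_not_le)
  qed
  then show ?thesis
    using D nonempty unfolding identifying_code_def by (auto simp: cycle_graph_def)
qed

subsection \<open>Vertex covers of the circulant graph\<close>

text \<open>The windows \<open>0..N-1\<close> and \<open>1..N\<close> differ only in their end
  points, where \<open>P\<close> agrees.\<close>

lemma card_shift_period:
  assumes "P N = P 0"
  shows "card {j. j < N \<and> P (Suc j)} = card {j. j < N \<and> P j}"
proof -
  have count: "card {j. j < N \<and> Q j} = (\<Sum>j<N. if Q j then 1 else 0 :: nat)" for Q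
  proof -
    have "{j. j < N \<and> Q j} = {j \<in> {..<N}. Q j}" by auto
    then show ?thesis by (simp add: sum.If_cases Int_def)
  qed
  have "(\<Sum>j<Suc N. if P j then 1 else 0 :: nat) = (\<Sum>j<N. if P j then 1 else 0) + (if P 0 then 1 else 0)"
    using assms by simp
  moreover have "(\<Sum>j<Suc N. if P j then 1 else 0 :: nat) =
      (if P 0 then 1 else 0) + (\<Sum>j<N. if P (Suc j) then 1 else 0)"
    by (rule sum.lessThan_Suc_shift)
  ultimately show ?thesis
    by (simp add: count)
qed

lemma card_even_shift: "card {j. j < 2 * h \<and> even (c + j)} = (h :: nat)"
proof (induction h)
  case (Suc h)
  have "{j. j < 2 * Suc h \<and> even (c + j)} =
          insert (if even c then 2 * h else Suc (2 * h)) {j. j < 2 * h \<and> even (c + j)}"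
    by (auto simp: less_Suc_eq split: if_splits)
  then show ?case
    using Suc by auto
qed simp

section \<open>Coordinates \<open>c + j * q\<close> on the cosets of the step
  \<open>q\<close>\<close>

locale cycle_steps =
  fixes n q g h :: nat
  assumes g_def: "g = gcd q n" and n_eq: "n = g * (2 * h + 1)" and n_pos: "0 < n"
begin

lemma g_pos: "0 < g"
  using n_eq n_pos by (cases g) auto

text \<open>Modulo \<open>g\<close>, which divides \<open>q\<close> and \<open>n\<close>, the
  multiples of \<open>q\<close> vanish, so \<open>c = d\<close>. Then \<open>g\<close> cancels from
  \<open>n\<close> and \<open>q\<close>, and the quotient \<open>q'\<close> is coprime to
  \<open>2 * h + 1\<close>.\<close>

lemma coset_eq:
  fixes c d i j :: int
  assumes "[c + i * int q = d + j * int q] (mod int n)"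
    and "0 \<le> c" "c < int g" "0 \<le> d" "d < int g"
  shows "c = d" "[i = j] (mod int (2 * h + 1))"
proof -
  have gq: "int g dvd int q" and gn: "int g dvd int n"
    by (simp_all add: g_def)
  have "[c + i * int q = d + j * int q] (mod int g)"
    using assms(1) gn by (rule cong_dvd_modulus)
  moreover have "[c + i * int q = c + 0] (mod int g)" "[d + j * int q = d + 0] (mod int g)"
    by (simp_all only: cong_iff_dvd_diff add_diff_cancel_left diff_zero dvd_mult[OF gq])
  ultimately have "[c = d] (mod int g)"
    by (metis add.right_neutral cong_sym cong_trans)
  then show "c = d"
    using assms(2-) by (simp add: cong_less_imp_eq_int)
  then have "[i * int q = j * int q] (mod int n)"
    using assms(1) by (simp add: cong_add_lcancel)
  then have dvd: "int n dvd (i - j) * int q"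
    by (simp add: cong_iff_dvd_diff left_diff_distrib)
  obtain q' where q': "q = g * q'"
    using gq by (auto simp: int_dvd_int_iff elim: dvdE)
  have "coprime q' (2 * h + 1)"
  proof -
    have "gcd (g * q') (g * (2 * h + 1)) = g"
      unfolding n_eq[symmetric] q'[symmetric] by (rule g_def[symmetric])
    then have "g * gcd q' (2 * h + 1) = g * 1"
      by (simp only: gcd_mult_distrib_nat mult_1_right)
    then show ?thesis
      using g_pos by (simp add: coprime_iff_gcd_eq_1)
  qed
  then have "coprime (int (2 * h + 1)) (int q')"
    by (simp only: coprime_int_iff coprime_commute)
  moreover have "int (2 * h + 1) dvd (i - j) * int q'"
  proof -
    have "int g * int (2 * h + 1) dvd int g * ((i - j) * int q')"
      using dvd unfolding n_eq q' by (simp only: of_nat_mult mult_ac)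
    then show ?thesis
      using g_pos by (simp only: dvd_mult_cancel_left) simp
  qed
  ultimately have "int (2 * h + 1) dvd i - j"
    by (simp only: coprime_dvd_mult_left_iff)
  then show "[i = j] (mod int (2 * h + 1))"
    by (simp only: cong_iff_dvd_diff)
qed

lemma int_coset: "int ((c + j * q) mod n) = (int c + int j * int q) mod int n"
  by (simp add: zmod_int)

text \<open>Injectivity is \<open>coset_eq\<close>; surjectivity follows by counting, as
  \<open>n = g * (2 * h + 1)\<close>.\<close>

lemma bij_betw_cosets:
  "bij_betw (\<lambda>(c, j). (c + j * q) mod n) ({..<g} \<times> {..<2 * h + 1}) {..<n}"
proof -
  let ?f = "\<lambda>(c, j). (c + j * q) mod n"
  have inj: "inj_on ?f ({..<g} \<times> {..<2 * h + 1})"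
  proof -
    have eq: "c = d \<and> i = j" if *: "c < g" "i < 2 * h + 1" "d < g" "j < 2 * h + 1"
      "(c + i * q) mod n = (d + j * q) mod n" for c i d j
    proof -
      have "[int c + int i * int q = int d + int j * int q] (mod int n)"
        unfolding cong_def int_coset[symmetric] *(5) ..
      from coset_eq[OF this] * have "int c = int d" "[int i = int j] (mod int (2 * h + 1))"
        by auto
      moreover from this(2) have "[i = j] (mod (2 * h + 1))"
        by (simp only: cong_int_iff)
      then have "i = j"
        using *(2,4) by (simp add: cong_less_modulus_unique_nat)
      ultimately show ?thesis
        by simp
    qed
    show ?thesis
      by (rule inj_onI) (auto dest!: eq[rotated -1])
  qed
  moreover have "?f ` ({..<g} \<times> {..<2 * h + 1}) = {..<n}"
  proof (rule card_subset_eq)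
    show "card (?f ` ({..<g} \<times> {..<2 * h + 1})) = card {..<n}"
      using inj by (simp add: card_image n_eq)
    show "?f ` ({..<g} \<times> {..<2 * h + 1}) \<subseteq> {..<n}"
      using n_pos by auto
  qed simp
  ultimately show ?thesis
    by (simp add: bij_betw_def)
qed

lemma card_eq_sum_cosets:
  assumes "D \<subseteq> {..<n}"
  shows "card D = (\<Sum>c<g. card {j. j < 2 * h + 1 \<and> mem_mod n D (int c + int j * int q)})"
proof -
  let ?f = "\<lambda>(c, j). (c + j * q) mod n"
  let ?S = "SIGMA c:{..<g}. {j. j < 2 * h + 1 \<and> mem_mod n D (int c + int j * int q)}"
  have mem: "mem_mod n D (int c + int j * int q) \<longleftrightarrow> (c + j * q) mod n \<in> D" for c j
    by (simp only: mem_mod_def int_coset[symmetric] nat_int)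
  have "inj_on ?f ?S"
    by (rule inj_on_subset[OF bij_betw_imp_inj_on[OF bij_betw_cosets]]) auto
  moreover have "?f ` ?S = D"
  proof
    show "?f ` ?S \<subseteq> D" by (auto simp: mem)
    show "D \<subseteq> ?f ` ?S"
    proof
      fix x assume "x \<in> D"
      then have "x \<in> ?f ` ({..<g} \<times> {..<2 * h + 1})"
        using assms bij_betw_imp_surj_on[OF bij_betw_cosets] by auto
      then obtain c j where "c < g" "j < 2 * h + 1" "x = (c + j * q) mod n"
        by auto
      then show "x \<in> ?f ` ?S"
        using \<open>x \<in> D\<close> by (intro image_eqI[of _ _ "(c, j)"]) (auto simp: mem)
    qed
  qed
  ultimately have "card D = card ?S"
    using card_image by fastforce
  also have "\<dots> = (\<Sum>c<g. card {j. j < 2 * h + 1 \<and> mem_mod n D (int c + int j * int q)})"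
    by (intro card_SigmaI) auto
  finally show ?thesis .
qed

lemma n_dvd: "int n dvd int (2 * h + 1) * int q"
proof -
  have "n dvd (2 * h + 1) * q"
    unfolding n_eq by (subst mult.commute) (intro mult_dvd_mono, simp, simp add: g_def)
  then show ?thesis
    by (simp only: int_dvd_int_iff of_nat_mult[symmetric])
qed

lemma mem_mod_period:
  "mem_mod n D (z + int (j + (2 * h + 1)) * int q) = mem_mod n D (z + int j * int q)"
proof (rule mem_mod_cong)
  have "z + int (j + (2 * h + 1)) * int q - (z + int j * int q) = int (2 * h + 1) * int q"
    by (simp add: algebra_simps)
  then show "[z + int (j + (2 * h + 1)) * int q = z + int j * int q] (mod int n)"
    using n_dvd by (simp only: cong_iff_dvd_diff)
qed

lemma card_coset_shift:
  "card {j. j < 2 * h + 1 \<and> mem_mod n D (z + int (Suc j) * int q)} =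
   card {j. j < 2 * h + 1 \<and> mem_mod n D (z + int j * int q)}"
  using mem_mod_period[of D z 0]
  by (intro card_shift_period[where P = "\<lambda>j. mem_mod n D (z + int j * int q)"]) simp

lemma cover_cosets:
  assumes "\<And>z. mem_mod n D z \<or> mem_mod n D (z + int q)"
  shows "{j. j < 2 * h + 1 \<and> mem_mod n D (z + int j * int q)} \<union>
         {j. j < 2 * h + 1 \<and> mem_mod n D (z + int (Suc j) * int q)} = {..<2 * h + 1}"
proof -
  have "mem_mod n D (z + int j * int q) \<or> mem_mod n D (z + int (Suc j) * int q)" for j
    using assms[of "z + int j * int q"] by (simp add: algebra_simps)
  then show ?thesis by auto
qed

text \<open>On each odd cycle the chosen indices and their shift by one are equally many and
  together exhaust \<open>2 * h + 1\<close> indices, so at least \<open>h + 1\<close> are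
  chosen.\<close>

lemma card_cover_ge:
  assumes "D \<subseteq> {..<n}" "\<And>z. mem_mod n D z \<or> mem_mod n D (z + int q)"
  shows "g * (h + 1) \<le> card D"
proof -
  have "h + 1 \<le> card {j. j < 2 * h + 1 \<and> mem_mod n D (int c + int j * int q)}" for c
  proof -
    have "2 * h + 1 = card {..<2 * h + 1}" by simp
    also have "\<dots> \<le> card {j. j < 2 * h + 1 \<and> mem_mod n D (int c + int j * int q)} +
        card {j. j < 2 * h + 1 \<and> mem_mod n D (int c + int (Suc j) * int q)}"
      unfolding cover_cosets[OF assms(2), of "int c", symmetric] by (rule card_Un_le)
    finally show ?thesis
      unfolding card_coset_shift by linarith
  qed
  then have "(\<Sum>c<g. h + 1) \<le> card D"
    unfolding card_eq_sum_cosets[OF assms(1)] by (intro sum_mono)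
  then show ?thesis by simp
qed

text \<open>A cover of the odd cycle with \<open>h + 1\<close> vertices contains both ends of exactly one edge,
  and from there on it alternates.\<close>

lemma minimum_cover_alternates:
  assumes "g = 1" and D: "D \<subseteq> {..<n}" "card D = h + 1"
    and cover: "\<And>z. mem_mod n D z \<or> mem_mod n D (z + int q)"
  obtains a :: int where "\<And>i. i < h \<Longrightarrow> \<not> mem_mod n D (a + int (2 * i) * int q)"
proof -
  define P where "P j = mem_mod n D (0 + int j * int q)" for j
  let ?A = "{j. j < 2 * h + 1 \<and> P j}" and ?B = "{j. j < 2 * h + 1 \<and> P (Suc j)}"
  have "card ?A = h + 1"
    using D card_eq_sum_cosets[OF D(1)] \<open>g = 1\<close> by (simp add: P_def)
  moreover have "card ?B = card ?A"
    unfolding P_def by (rule card_coset_shift)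
  moreover have "?A \<union> ?B = {..<2 * h + 1}"
    unfolding P_def by (rule cover_cosets[OF cover])
  \<comment> \<open>\<open>?A\<close> \<inter> \<open>?B\<close> indexes the edges with both ends in
    \<open>D\<close>; inclusion-exclusion leaves \<open>2 * (h + 1) - (2 * h + 1) = 1\<close> of
    them.\<close>
  moreover have "card ?A + card ?B = card (?A \<union> ?B) + card (?A \<inter> ?B)"
    by (rule card_Un_Int) auto
  ultimately have "2 * h + 2 = 2 * h + 1 + card (?A \<inter> ?B)"
    by (simp only: card_lessThan)
  then have "card (?A \<inter> ?B) = 1"
    by linarith
  then obtain b where b: "?A \<inter> ?B = {b}"
    by (auto simp: card_1_singleton_iff)
  have period: "P (j mod (2 * h + 1)) = P j" for j
  proof -
    have "P (i + d * (2 * h + 1)) = P i" for i d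
    proof (induction d)
      case (Suc d)
      have "i + Suc d * (2 * h + 1) = (i + d * (2 * h + 1)) + (2 * h + 1)" by simp
      then show ?case
        using Suc mem_mod_period[of D 0 "i + d * (2 * h + 1)"] by (simp only: P_def)
    qed simp
    from this[of "j mod (2 * h + 1)" "j div (2 * h + 1)"] show ?thesis
      by (simp only: mod_mult_div_eq mult.commute mod_div_mult_eq)
  qed
  \<comment> \<open>A second such edge would reduce modulo \<open>2 * h + 1\<close> to the edge at
    \<open>b\<close>.\<close>
  have once: "\<not> (P (b + i) \<and> P (Suc (b + i)))" if "0 < i" "i < 2 * h + 1" for i
  proof
    assume *: "P (b + i) \<and> P (Suc (b + i))"
    have "P (Suc ((b + i) mod (2 * h + 1))) = P (Suc (b + i))"
      using period[of "Suc ((b + i) mod (2 * h + 1))"]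
      unfolding mod_Suc_eq period[of "Suc (b + i)"] by (rule sym)
    then have "P ((b + i) mod (2 * h + 1))" "P (Suc ((b + i) mod (2 * h + 1)))"
      using * by (simp_all only: period)
    then have "(b + i) mod (2 * h + 1) \<in> ?A \<inter> ?B"
      by simp
    then have "(b + i) mod (2 * h + 1) = b"
      unfolding b by (rule singletonD)
    moreover have "b \<in> ?A \<inter> ?B"
      unfolding b by simp
    then have "b < 2 * h + 1"
      by blast
    ultimately have "(b + i) mod (2 * h + 1) = b mod (2 * h + 1)"
      by (simp only: mod_less)
    then have "[b + i = b + 0] (mod (2 * h + 1))"
      by (simp add: cong_def)
    then have "[i = 0] (mod (2 * h + 1))"
      by (simp only: cong_add_lcancel_nat)
    then show False
      using that by (simp add: cong_def)
  qed
  have cov: "P j \<or> P (Suc j)" for j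
    using cover[of "0 + int j * int q"] by (simp add: P_def algebra_simps)
  have alt: "P (Suc (b + 2 * i))" if "i \<le> h" for i
    using that
  proof (induction i)
    case 0
    then show ?case using b by auto
  next
    case (Suc i)
    then show ?case
      using once[of "Suc (2 * i)"] cov[of "Suc (Suc (b + 2 * i))"] by auto
  qed
  \<comment> \<open>Both \<open>b\<close> and \<open>b + 1\<close> are in the cover, so the omitted
    indices start at \<open>b + 2\<close>, the source of the witness.\<close>
  have "\<not> P (b + 2 + 2 * i)" if "i < h" for i
    using once[of "Suc (2 * i)"] alt[of i] that by auto
  then show thesis
    by (intro that[of "int (b + 2) * int q"]) (simp add: P_def algebra_simps)
qed

section \<open>The parity code and the arcs it misses\<close>

text \<open>A minimum cover: each cycle omits \<open>h\<close> alternate indices, with the phase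
  switching between neighbouring cosets so that runs break up. The bound is \<open>2 * h\<close>
  because index \<open>2 * h\<close> is adjacent to index 0 on the odd cycle.\<close>

definition parity_code :: "nat set" where
  "parity_code = {..<n} -
     (\<lambda>(c, j). (c + j * q) mod n) ` (SIGMA c:{..<g}. {j. j < 2 * h \<and> even (c + j)})"

lemma card_parity_code: "card parity_code = g * (h + 1)"
proof -
  let ?S = "SIGMA c:{..<g}. {j. j < 2 * h \<and> even (c + j)}"
  let ?f = "\<lambda>(c, j). (c + j * q) mod n"
  have "inj_on ?f ?S"
    by (rule inj_on_subset[OF bij_betw_imp_inj_on[OF bij_betw_cosets]]) auto
  then have "card (?f ` ?S) = card ?S"
    by (rule card_image)
  also have "\<dots> = (\<Sum>c<g. card {j. j < 2 * h \<and> even (c + j)})"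
    by (intro card_SigmaI) auto
  also have "\<dots> = g * h"
    by (simp only: card_even_shift) simp
  finally have "card (?f ` ?S) = g * h" .
  moreover have "?f ` ?S \<subseteq> {..<n}"
    using n_pos by auto
  ultimately show ?thesis
    unfolding parity_code_def
    by (subst card_Diff_subset) (auto simp: n_eq algebra_simps intro: finite_subset)
qed

lemma not_mem_parity_codeE:
  assumes "\<not> mem_mod n parity_code z"
  obtains c j where "c < g" "j < 2 * h" "even (c + j)" "[z = int c + int j * int q] (mod int n)"
proof -
  have "nat (z mod int n) < n"
    using n_pos by (simp add: nat_less_iff)
  then obtain c j where cj: "c < g" "j < 2 * h" "even (c + j)" "nat (z mod int n) = (c + j * q) mod n"
    using assms unfolding mem_mod_def parity_code_def by auto
  have "z mod int n = int (nat (z mod int n))"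
    using n_pos by simp
  also have "\<dots> = (int c + int j * int q) mod int n"
    unfolding cj(4) int_coset ..
  finally show thesis
    using that cj by (simp add: cong_def)
qed

text \<open>Omitted indices of one coset share their parity and stay below \<open>2 * h\<close>, so
  no two are consecutive, not even around the end of the cycle.\<close>

lemma parity_code_cover: "mem_mod n parity_code z \<or> mem_mod n parity_code (z + int q)"
proof (rule ccontr)
  assume "\<not> ?thesis"
  then obtain c i d j where
    cd: "c < g" "i < 2 * h" "even (c + i)" "[z = int c + int i * int q] (mod int n)"
      "d < g" "j < 2 * h" "even (d + j)" "[z + int q = int d + int j * int q] (mod int n)"
    by (metis not_mem_parity_codeE)
  have "[int c + int i * int q + int q = z + int q] (mod int n)"
    using cd(4) by (intro cong_add) (auto simp: cong_sym)
  then have "[int c + int (Suc i) * int q = int d + int j * int q] (mod int n)"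
    using cd(8) cong_trans by (simp add: algebra_simps) blast
  from coset_eq[OF this] cd have "c = d" "[int (Suc i) = int j] (mod int (2 * h + 1))"
    by auto
  then have "[Suc i = j] (mod (2 * h + 1))"
    by (simp only: cong_int_iff)
  then have "Suc i = j"
    using cd by (simp add: cong_less_modulus_unique_nat)
  then show False
    using cd \<open>c = d\<close> by auto
qed

text \<open>The run contains two consecutive integers from the cosets of 0 and 1; they have the same
  index \<open>j\<close>, but the code omits even indices in the one coset and odd ones in the other.\<close>

lemma parity_code_hits_run:
  assumes "2 \<le> g" "g < q"
  shows "\<exists>t\<in>{0..<int q}. mem_mod n parity_code (z + t)"
proof (rule ccontr)
  assume no: "\<not> ?thesis"
  \<comment> \<open>The least offset that makes \<open>z + t\<close> a multiple of \<open>g\<close>;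
    since \<open>g < q\<close>, also \<open>t + 1\<close> is still inside the run.\<close>
  define t where "t = (- z) mod int g"
  have t: "0 \<le> t" "t < int g"
    using g_pos by (auto simp: t_def)
  have "\<not> mem_mod n parity_code (z + t)" "\<not> mem_mod n parity_code (z + (t + 1))"
    using no t assms by auto
  then obtain c i d j where
    cd: "c < g" "i < 2 * h" "even (c + i)" "[z + t = int c + int i * int q] (mod int n)"
      "d < g" "j < 2 * h" "even (d + j)" "[z + (t + 1) = int d + int j * int q] (mod int n)"
    by (metis not_mem_parity_codeE)
  have gq: "int g dvd int q" and gn: "int g dvd int n"
    by (simp_all add: g_def)
  have "[z + t = 0] (mod int g)"
    by (simp add: t_def cong_def mod_add_right_eq)
  moreover have "[z + t = int c + int i * int q] (mod int g)"
    using cd(4) gn by (rule cong_dvd_modulus)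
  moreover have "[int c + int i * int q = int c + 0] (mod int g)"
    by (simp only: cong_iff_dvd_diff add_diff_cancel_left diff_zero dvd_mult[OF gq])
  ultimately have "[int c = 0] (mod int g)"
    by (metis add.right_neutral cong_sym cong_trans)
  then have "c = 0"
    using cd(1) by (simp add: cong_def)
  have "[z + t + 1 = int c + int i * int q + 1] (mod int n)"
    by (rule cong_add[OF cd(4) cong_refl])
  then have "[1 + int i * int q = int d + int j * int q] (mod int n)"
    using cd(8) \<open>c = 0\<close> by (simp add: algebra_simps) (metis cong_sym cong_trans)
  from coset_eq[OF this] cd assms have "1 = int d" "[int i = int j] (mod int (2 * h + 1))"
    by auto
  then have "[i = j] (mod (2 * h + 1))" "d = 1"
    by (simp_all only: cong_int_iff)
  then have "i = j"
    using cd by (simp add: cong_less_modulus_unique_nat)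
  then show False
    using cd \<open>c = 0\<close> \<open>d = 1\<close> by auto
qed

text \<open>In terms of the index \<open>j\<close> of \<open>j * q\<close>, a run missed by the code is an arithmetic
  progression without wrap-around; its difference \<open>u\<close> is the even inverse of \<open>q\<close>.\<close>

lemma parity_code_two_runsD:
  assumes "g = 1" "2 \<le> q" and ne: "\<not> [z = w] (mod int n)"
    and miss: "\<And>t. t \<in> {0..<int q} \<Longrightarrow> \<not> mem_mod n parity_code (z + t)"
              "\<And>t. t \<in> {0..<int q} \<Longrightarrow> \<not> mem_mod n parity_code (w + t)"
  obtains u :: int where "even u" "[u * int q = 1] (mod int n)" "(int q - 1) * \<bar>u\<bar> \<le> int n - 5"
proof -
  have idx: "\<exists>i. \<forall>t<q. even (i t) \<and> 0 \<le> i t \<and> i t \<le> 2 * int h - 2 \<and>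
                 [y + int t = i t * int q] (mod int n)"
    if "\<And>t. t \<in> {0..<int q} \<Longrightarrow> \<not> mem_mod n parity_code (y + t)" for y
  proof -
    have "\<exists>a. even a \<and> 0 \<le> a \<and> a \<le> 2 * int h - 2 \<and> [y + int t = a * int q] (mod int n)"
      if t: "t < q" for t
    proof -
      have "\<not> mem_mod n parity_code (y + int t)"
        using that t \<open>\<And>t. t \<in> {0..<int q} \<Longrightarrow> \<not> mem_mod n parity_code (y + t)\<close> by auto
      then obtain c j where "c < g" "j < 2 * h" "even (c + j)"
          "[y + int t = int c + int j * int q] (mod int n)"
        by (rule not_mem_parity_codeE)
      then show ?thesis
        using \<open>g = 1\<close> by (intro exI[of _ "int j"]) (auto elim!: evenE)
    qed
    then show ?thesis by metis
  qed
  obtain i where i: "\<And>t. t < q \<Longrightarrow> even (i t)" "\<And>t. t < q \<Longrightarrow> 0 \<le> i t"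
      "\<And>t. t < q \<Longrightarrow> i t \<le> 2 * int h - 2"
      "\<And>t. t < q \<Longrightarrow> [z + int t = i t * int q] (mod int n)"
    using idx[of z] miss(1) by blast
  obtain i' where i': "\<And>t. t < q \<Longrightarrow> even (i' t)" "\<And>t. t < q \<Longrightarrow> 0 \<le> i' t"
      "\<And>t. t < q \<Longrightarrow> i' t \<le> 2 * int h - 2"
      "\<And>t. t < q \<Longrightarrow> [w + int t = i' t * int q] (mod int n)"
    using idx[of w] miss(2) by blast
  define u where "u = i 1 - i 0"
  have u: "even u" "\<bar>u\<bar> \<le> 2 * int h - 2"
    using i[of 0] i[of 1] \<open>2 \<le> q\<close> by (auto simp: u_def)
  \<comment> \<open>Both \<open>b - a\<close> and \<open>u\<close> invert \<open>q\<close>, so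
    \<open>2 * h + 1\<close> divides \<open>b - a - u\<close>. This number is even, hence divisible
    by \<open>2 * (2 * h + 1)\<close>, and too small to be nonzero.\<close>
  have step: "b = a + u"
    if a: "even a" "0 \<le> a" "a \<le> 2 * int h - 2" "[y = a * int q] (mod int n)"
      and b: "even b" "0 \<le> b" "b \<le> 2 * int h - 2" "[y + 1 = b * int q] (mod int n)"
    for a b y
  proof -
    have 1: "[1 = (b - a) * int q] (mod int n)"
      using cong_diff[OF b(4) a(4)] by (simp add: left_diff_distrib)
    have 2: "[1 = u * int q] (mod int n)"
      using cong_diff[OF i(4)[of 1] i(4)[of 0]] \<open>2 \<le> q\<close> by (simp add: u_def left_diff_distrib)
    have "[0 + (b - a) * int q = 0 + u * int q] (mod int n)"
      using cong_trans[OF cong_sym[OF 1] 2] by simp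
    from coset_eq(2)[OF this] have "[b - a = u] (mod int (2 * h + 1))"
      using \<open>g = 1\<close> by simp
    then have "int (2 * h + 1) dvd b - a - u"
      by (simp only: cong_iff_dvd_diff)
    moreover have "coprime 2 (int (2 * h + 1))"
      by simp
    moreover have "2 dvd b - a - u"
      using a(1) b(1) u(1) by simp
    ultimately have dvd: "2 * int (2 * h + 1) dvd b - a - u"
      by (intro divides_mult)
    have "\<bar>b - a - u\<bar> < 2 * int (2 * h + 1)"
      using a b u(2) by auto
    then have "b - a - u = 0"
      using dvd_imp_le_int[OF _ dvd] by (cases "b - a - u = 0") linarith+
    then show ?thesis by simp
  qed
  have progression: "i t = i 0 + int t * u" "i' t = i' 0 + int t * u" if "t < q" for t
  proof -
    have "i t = i 0 + int t * u \<and> i' t = i' 0 + int t * u"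
      using that
    proof (induction t)
      case (Suc t)
      then have "i (Suc t) = i t + u"
        using i[of t] i[of "Suc t"] by (intro step[of _ "z + int t"]) (auto simp: add_ac)
      moreover have "i' (Suc t) = i' t + u"
        using Suc i'[of t] i'[of "Suc t"] by (intro step[of _ "w + int t"]) (auto simp: add_ac)
      ultimately show ?case
        using Suc by (simp add: algebra_simps)
    qed simp
    then show "i t = i 0 + int t * u" "i' t = i' 0 + int t * u"
      by auto
  qed
  have inv: "[u * int q = 1] (mod int n)"
    using cong_diff[OF i(4)[of 1] i(4)[of 0]] \<open>2 \<le> q\<close>
    by (simp add: u_def left_diff_distrib cong_sym)
  have "i 0 \<noteq> i' 0"
    using ne i(4)[of 0] i'(4)[of 0] \<open>2 \<le> q\<close> cong_trans cong_sym
    by (metis add.right_neutral less_le_trans of_nat_0 zero_less_numeral)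
  moreover have "i (q - 1) = i 0 + (int q - 1) * u" "i' (q - 1) = i' 0 + (int q - 1) * u"
    using progression[of "q - 1"] \<open>2 \<le> q\<close> by (auto simp: of_nat_diff)
  moreover have "even (i 0)" "even (i' 0)"
    using i(1)[of 0] i'(1)[of 0] \<open>2 \<le> q\<close> by auto
  moreover have "0 \<le> i 0" "0 \<le> i' 0" "0 \<le> i (q - 1)" "0 \<le> i' (q - 1)"
     "i 0 \<le> 2 * int h - 2" "i' 0 \<le> 2 * int h - 2" "i (q - 1) \<le> 2 * int h - 2" "i' (q - 1) \<le> 2 * int h - 2"
    using i(2,3)[of 0] i'(2,3)[of 0] i(2,3)[of "q - 1"] i'(2,3)[of "q - 1"] \<open>2 \<le> q\<close> by auto
  \<comment> \<open>The two progressions are translates of each other by a nonzero even number and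
    both lie in \<open>0..2h-2\<close>, so each spans at most \<open>2 * h - 4\<close>, which is
    \<open>n - 5\<close>.\<close>
  ultimately have "\<bar>(int q - 1) * u\<bar> \<le> 2 * int h - 4"
    by presburger
  then have "(int q - 1) * \<bar>u\<bar> \<le> int n - 5"
    using \<open>2 \<le> q\<close> \<open>g = 1\<close> by (simp add: abs_mult n_eq)
  with u(1) inv show thesis
    by (rule that)
qed

text \<open>Since \<open>u * q\<close> is congruent to 1, consecutive vertices have indices in
  arithmetic progression with difference \<open>u\<close>. Among the omitted even indices
  \<open>0..2h-2\<close> a progression of span at most \<open>2 * h - 4\<close> fits together with
  its translate by 2.\<close>

lemma minimum_cover_two_runs:
  assumes "g = 1" and u: "even u" "[u * int q = 1] (mod int n)" "(int q - 1) * \<bar>u\<bar> \<le> int n - 5"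
    and D: "D \<subseteq> {..<n}" "card D = h + 1" and "1 \<le> q"
    and cover: "\<And>z. mem_mod n D z \<or> mem_mod n D (z + int q)"
  obtains z w where "\<not> [z = w] (mod int n)"
    "\<And>t. t \<in> {0..<int q} \<Longrightarrow> \<not> mem_mod n D (z + t)"
    "\<And>t. t \<in> {0..<int q} \<Longrightarrow> \<not> mem_mod n D (w + t)"
proof -
  obtain a where a: "\<And>i. i < h \<Longrightarrow> \<not> mem_mod n D (a + int (2 * i) * int q)"
    using minimum_cover_alternates[OF \<open>g = 1\<close> D cover] by blast
  \<comment> \<open>The progression starts at 0 if it ascends, and at its top value if it descends
    to 0.\<close>
  define p where "p = (if 0 \<le> u then 0 else (int q - 1) * (- u))"
  have n: "int n = 2 * int h + 1"
    using \<open>g = 1\<close> by (simp add: n_eq)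
  have "0 \<le> (int q - 1) * \<bar>u\<bar>"
    using \<open>1 \<le> q\<close> by simp
  then have h: "2 \<le> h"
    using u(3) n by linarith
  have p: "even p"
    using u(1) by (auto simp: p_def)
  have bounds: "0 \<le> p + t * u" "p + t * u \<le> 2 * int h - 4" if t: "0 \<le> t" "t < int q" for t
  proof -
    have "0 \<le> p + t * u \<and> p + t * u \<le> (int q - 1) * \<bar>u\<bar>"
    proof (cases "0 \<le> u")
      case True
      then show ?thesis
        using t by (auto simp: p_def intro: mult_right_mono)
    next
      case False
      have "p + t * u = (int q - 1 - t) * (- u)"
        using False by (simp add: p_def algebra_simps)
      moreover have "(int q - 1 - t) * (- u) \<le> (int q - 1) * (- u)"
        using False t by (intro mult_right_mono) auto
      ultimately show ?thesis
        using False t by (simp add: mult_nonneg_nonpos)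
    qed
    then show "0 \<le> p + t * u" "p + t * u \<le> 2 * int h - 4"
      using u(3) n by auto
  qed
  \<comment> \<open>\<open>e\<close> selects the progression or its translate; an offset
    \<open>t\<close> turns into the index shift \<open>t * u\<close>.\<close>
  have miss: "\<not> mem_mod n D (a + (p + e) * int q + t)"
    if t: "t \<in> {0..<int q}" and e: "e = 0 \<or> e = 2" for t e
  proof -
    have "even (p + e + t * u)"
      using p e u(1) by auto
    then obtain x where x: "p + e + t * u = 2 * x"
      by (elim evenE)
    then have "0 \<le> x" "x < int h"
      using bounds[of t] t e by auto
    then have "\<not> mem_mod n D (a + int (2 * nat x) * int q)"
      by (intro a) auto
    moreover have "int (2 * nat x) = p + e + t * u"
      using \<open>0 \<le> x\<close> x by simp
    moreover have "[a + (p + e) * int q + t * (u * int q) = a + (p + e) * int q + t * 1] (mod int n)"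
      using u(2) by (intro cong_add cong_mult cong_refl)
    then have "mem_mod n D (a + (p + e + t * u) * int q) = mem_mod n D (a + (p + e) * int q + t)"
      by (intro mem_mod_cong) (simp add: algebra_simps)
    ultimately show ?thesis by simp
  qed
  have "\<not> [a + (p + 0) * int q = a + (p + 2) * int q] (mod int n)"
  proof
    assume "[a + (p + 0) * int q = a + (p + 2) * int q] (mod int n)"
    then have "[0 + (p + 0) * int q = 0 + (p + 2) * int q] (mod int n)"
      by (simp only: cong_add_lcancel)
    from coset_eq(2)[OF this] have "[p + 0 = p + 2] (mod int (2 * h + 1))"
      using \<open>g = 1\<close> by simp
    then have "int (2 * h + 1) dvd (p + 0) - (p + 2)"
      by (simp only: cong_iff_dvd_diff)
    then have "int (2 * h + 1) dvd 2"
      by simp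
    then show False
      using h zdvd_imp_le[of "int (2 * h + 1)" 2] by simp
  qed
  then show thesis
    using miss[of _ 0] miss[of _ 2] by (intro that) auto
qed

end

section \<open>Even inverses of \<open>q\<close> and the two exceptional cases\<close>

text \<open>The bound forces \<open>u * q - 1 = n * s\<close> with \<open>s\<close> equal to 1 or
  -1, as \<open>s = 0\<close> contradicts the parity of \<open>u\<close>. Uniqueness of quotient and
  remainder then gives \<open>l = u - 1\<close>, \<open>m = q - 1\<close> or \<open>l = -u\<close>,
  \<open>m = 1\<close>.\<close>

lemma even_inverse_iff:
  fixes n q l m :: nat
  assumes n: "n = l * q + m" "m < q" and "even q" "4 \<le> q" "3 \<le> l" "odd n"
  shows "(\<exists>u::int. even u \<and> [u * int q = 1] (mod int n) \<and> (int q - 1) * \<bar>u\<bar> \<le> int n - 5) \<longleftrightarrow>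
           (odd l \<and> m = q - 1 \<and> 5 * q \<le> n) \<or> (even l \<and> m = 1)"
proof
  assume "\<exists>u::int. even u \<and> [u * int q = 1] (mod int n) \<and> (int q - 1) * \<bar>u\<bar> \<le> int n - 5"
  then obtain u :: int where u: "even u" "[u * int q = 1] (mod int n)"
      "(int q - 1) * \<bar>u\<bar> \<le> int n - 5" by blast
  have "3 * \<bar>u\<bar> \<le> (int q - 1) * \<bar>u\<bar>"
    using \<open>4 \<le> q\<close> by (intro mult_right_mono) auto
  then have "\<bar>u\<bar> * int q < 2 * int n - 1"
    using u(3) by (simp add: algebra_simps)
  then have "\<bar>u * int q\<bar> < 2 * int n - 1"
    by (simp add: abs_mult)
  then have small: "\<bar>u * int q - 1\<bar> < 2 * int n"
    by linarith
  obtain s where s: "u * int q - 1 = int n * s"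
    using u(2) by (auto simp: cong_iff_dvd_diff)
  have "int n * \<bar>s\<bar> < int n * 2"
    using small unfolding s by (simp add: abs_mult)
  then have "\<bar>s\<bar> < 2"
    by (simp add: mult_less_cancel_left)
  moreover have "s \<noteq> 0"
  proof
    assume "s = 0"
    then have "u * int q = 1" using s by simp
    then show False using u(1) by (metis even_mult_iff odd_one)
  qed
  ultimately consider "s = 1" | "s = -1" by linarith
  then show "(odd l \<and> m = q - 1 \<and> 5 * q \<le> n) \<or> (even l \<and> m = 1)"
  proof cases
    case 1
    have "0 < u"
    proof (rule ccontr)
      assume "\<not> 0 < u"
      then have "u * int q \<le> 0" by (simp add: mult_nonpos_nonneg)
      then show False using s 1 by simp
    qed
    define v where "v = nat (u - 1)"
    have v: "u = int v + 1" using \<open>0 < u\<close> by (simp add: v_def)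
    have "int n = int (v * q + (q - 1))"
      using s 1 \<open>4 \<le> q\<close> by (simp add: v algebra_simps of_nat_diff)
    then have vn: "n = v * q + (q - 1)"
      by (simp only: of_nat_eq_iff)
    have "(v * q + s) div q = v" "(v * q + s) mod q = s" if "s < q" for s
      using that by simp_all
    from this[of "q - 1"] have "n div q = v" "n mod q = q - 1"
      unfolding vn using \<open>4 \<le> q\<close> by simp_all
    moreover have "n div q = l" "n mod q = m"
      unfolding n(1) using n(2) by auto
    ultimately have lm: "l = v" "m = q - 1" by auto
    have "odd l" using u(1) v lm by simp
    \<comment> \<open>The left side equals \<open>n - v\<close>, so the bound says exactly that
      \<open>v\<close> is at least 5.\<close>
    moreover have "(int q - 1) * (int v + 1) \<le> int (v * q + (q - 1)) - 5"
      using u(3) v \<open>0 < u\<close> vn by simp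
    then have "5 \<le> v"
      using \<open>4 \<le> q\<close> by (simp add: algebra_simps of_nat_diff)
    then have "5 * q \<le> n"
      unfolding vn by (simp add: trans_le_add1)
    ultimately show ?thesis using lm by simp
  next
    case 2
    have "u < 0"
    proof (rule ccontr)
      assume "\<not> u < 0"
      then have "0 \<le> u * int q" by simp
      moreover have "3 * 4 \<le> l * q"
        using \<open>4 \<le> q\<close> \<open>3 \<le> l\<close> by (intro mult_le_mono)
      then have "1 < int n" using n(1) by linarith
      ultimately show False using s unfolding 2 by linarith
    qed
    define v where "v = nat (- u)"
    have v: "u = - int v" using \<open>u < 0\<close> by (simp add: v_def)
    have "int n = int (v * q + 1)"
      using s 2 by (simp add: v algebra_simps)
    then have vn: "n = v * q + 1"
      by (simp only: of_nat_eq_iff)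
    have "(v * q + s) div q = v" "(v * q + s) mod q = s" if "s < q" for s
      using that by simp_all
    from this[of 1] have "n div q = v" "n mod q = 1"
      unfolding vn using \<open>4 \<le> q\<close> by simp_all
    moreover have "n div q = l" "n mod q = m"
      unfolding n(1) using n(2) by auto
    ultimately show ?thesis
      using u(1) v by simp
  qed
next
  assume "(odd l \<and> m = q - 1 \<and> 5 * q \<le> n) \<or> (even l \<and> m = 1)"
  then show "\<exists>u::int. even u \<and> [u * int q = 1] (mod int n) \<and> (int q - 1) * \<bar>u\<bar> \<le> int n - 5"
  proof
    assume *: "odd l \<and> m = q - 1 \<and> 5 * q \<le> n"
    have e: "int n = (int l + 1) * int q - 1"
      using n * \<open>4 \<le> q\<close> by (simp add: algebra_simps of_nat_diff)
    have "5 \<le> l"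
    proof (rule ccontr)
      assume "\<not> 5 \<le> l"
      then have "l * q \<le> 4 * q" by (intro mult_right_mono) auto
      then show False using n * by linarith
    qed
    moreover have "[(int l + 1) * int q = 1] (mod int n)"
      unfolding cong_iff_dvd_diff by (simp only: e[symmetric] dvd_refl)
    moreover have "(int q - 1) * \<bar>int l + 1\<bar> = int n - int l"
      using e by (simp add: algebra_simps)
    ultimately show ?thesis
      using * by (intro exI[of _ "int l + 1"]) auto
  next
    assume *: "even l \<and> m = 1"
    \<comment> \<open>Here the product to be bounded is \<open>n - 1 - l\<close>, so
      \<open>l\<close> must be at least 4; parity rules out 3.\<close>
    then have "4 \<le> l" using \<open>3 \<le> l\<close> by (cases "l = 3") auto
    have e: "int n = int l * int q + 1"
      using n * by simp
    have "- int l * int q - 1 = - int n"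
      using e by simp
    then have "[- int l * int q = 1] (mod int n)"
      by (simp only: cong_iff_dvd_diff dvd_minus_iff dvd_refl)
    moreover have "(int q - 1) * \<bar>- int l\<bar> = int n - 1 - int l"
      using e by (simp add: algebra_simps)
    ultimately show ?thesis
      using * \<open>4 \<le> l\<close> by (intro exI[of _ "- int l"]) auto
  qed
qed

subsection \<open>Codes for the exceptional cases\<close>

text \<open>Alternating full and empty blocks of length \<open>q\<close> would be missed in whole runs; swapping
  the second element of every block destroys all runs at the cost of one element.\<close>

definition defect :: "nat \<Rightarrow> nat \<Rightarrow> bool" where
  "defect q x \<longleftrightarrow> even (x div q) \<noteq> (x mod q = 1)"

lemma defect_block: "s < q \<Longrightarrow> defect q (i * q + s) \<longleftrightarrow> even i \<noteq> (s = 1)"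
  by (simp add: defect_def)

lemma card_defect_Suc:
  "card {x. x < Suc N \<and> defect q x} = card {x. x < N \<and> defect q x} + (if defect q N then 1 else 0)"
proof -
  have "{x. x < Suc N \<and> defect q x} =
          (if defect q N then insert N {x. x < N \<and> defect q x} else {x. x < N \<and> defect q x})"
    by (auto simp: less_Suc_eq)
  then show ?thesis by simp
qed

lemma card_defect_block:
  assumes "t \<le> q"
  shows "card {x. x < i * q + t \<and> defect q x} = card {x. x < i * q \<and> defect q x} +
           (if even i then if 2 \<le> t then t - 1 else t else if 2 \<le> t then 1 else 0)"
  using assms
proof (induction t)
  case (Suc t)
  then show ?case
    by (simp add: card_defect_Suc defect_block del: mult_Suc)
qed simp

text \<open>An even block contributes \<open>q - 1\<close> defects and an odd block one, hence
  \<open>q\<close> per pair.\<close>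

lemma card_defect_even:
  assumes "2 \<le> q"
  shows "card {x. x < 2 * i * q \<and> defect q x} = i * q"
proof (induction i)
  case (Suc i)
  have e1: "2 * Suc i * q = (2 * i + 1) * q + q" and e2: "(2 * i + 1) * q = 2 * i * q + q"
    by (simp_all add: algebra_simps)
  have "card {x. x < 2 * Suc i * q \<and> defect q x} = card {x. x < (2 * i + 1) * q \<and> defect q x} + 1"
    unfolding e1 using assms card_defect_block[of q q "2 * i + 1"] by simp
  also have "card {x. x < (2 * i + 1) * q \<and> defect q x} = i * q + (q - 1)"
    unfolding e2 using Suc assms card_defect_block[of q q "2 * i"] by simp
  also have "i * q + (q - 1) + 1 = Suc i * q"
    using assms by simp
  finally show ?case .
qed simp

lemma card_defect_odd:
  assumes "2 \<le> q"
  shows "card {x. x < (2 * i + 1) * q \<and> defect q x} = i * q + q - 1"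
proof -
  have eq: "(2 * i + 1) * q = 2 * i * q + q"
    by (simp add: algebra_simps)
  show ?thesis
    unfolding eq using card_defect_even[OF assms, of i] assms card_defect_block[of q q "2 * i"] by simp
qed

text \<open>The last \<open>q\<close> vertices all stay in the code, so neither an uncovered edge
  nor a missed run can wrap around.\<close>

definition defect_code :: "nat \<Rightarrow> nat \<Rightarrow> nat set" where
  "defect_code n q = {..<n} - {x. x < n - q \<and> defect q x}"

text \<open>The alternatives are \<open>m = 1\<close>, \<open>l = 2 * j\<close> and
  \<open>m = q - 1\<close>, \<open>l = 2 * j - 1\<close>. The range below \<open>n - q\<close> is
  one longer or one shorter than \<open>2 * j - 1\<close> full blocks and holds \<open>k - 1\<close>
  defects either way.\<close>

lemma card_defect_code:
  assumes "3 \<le> q" "1 \<le> j" "2 * k + 1 = 2 * j * q + 1 \<or> 2 * k + 2 = 2 * j * q"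
  shows "card (defect_code (2 * k + 1) q) = k + 2"
proof -
  obtain i where i: "j = Suc i"
    using assms(2) by (cases j) auto
  have jq: "j * q = i * q + q" "2 * j * q = (2 * i + 1) * q + q"
    by (simp_all add: i algebra_simps)
  have "card {x. x < 2 * k + 1 - q \<and> defect q x} = k - 1"
    using assms(3)
  proof
    assume k: "2 * k + 1 = 2 * j * q + 1"
    then have eq: "2 * k + 1 - q = Suc ((2 * i + 1) * q)"
      using jq by simp
    \<comment> \<open>The surplus position opens an odd block and is no defect.\<close>
    have "\<not> defect q ((2 * i + 1) * q)"
      using defect_block[of 0 q "2 * i + 1"] assms(1) by simp
    then show ?thesis
      unfolding eq card_defect_Suc
      using card_defect_odd[of q i] assms(1) k jq(1) by simp
  next
    assume k: "2 * k + 2 = 2 * j * q"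
    then have eq: "(2 * i + 1) * q = Suc (2 * k + 1 - q)"
      using jq assms(1) by simp
    have "2 * k + 1 - q = 2 * i * q + (q - 1)"
      using eq assms(1) by (simp add: algebra_simps)
    \<comment> \<open>The lacking position closes an even block and would be a defect, as
      \<open>q - 1\<close> differs from 1.\<close>
    then have "defect q (2 * k + 1 - q)"
      using defect_block[of "q - 1" q "2 * i"] assms(1) by simp
    then have "card {x. x < (2 * i + 1) * q \<and> defect q x} =
        card {x. x < 2 * k + 1 - q \<and> defect q x} + 1"
      unfolding eq card_defect_Suc by simp
    then show ?thesis
      using card_defect_odd[of q i] assms(1) k jq(1) by simp
  qed
  moreover have "card (defect_code (2 * k + 1) q) =
      2 * k + 1 - card {x. x < 2 * k + 1 - q \<and> defect q x}"
    unfolding defect_code_def by (subst card_Diff_subset) auto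
  moreover have "1 \<le> k"
  proof -
    have "q \<le> j * q" using assms(2) by simp
    moreover have "2 * j * q = 2 * (j * q)" by simp
    ultimately show ?thesis using assms(1,3) by linarith
  qed
  ultimately show ?thesis by simp
qed

lemma not_mem_defect_code:
  assumes "nat (z mod int n) + s < n"
  shows "\<not> mem_mod n (defect_code n q) (z + int s) \<longleftrightarrow>
           nat (z mod int n) + s < n - q \<and> defect q (nat (z mod int n) + s)"
proof -
  have pos: "0 \<le> z mod int n" using assms by simp
  have "(z + int s) mod int n = (z mod int n + int s) mod int n"
    by (simp add: mod_add_left_eq)
  also have "\<dots> = z mod int n + int s"
    using assms pos by (intro mod_pos_pos_trivial) auto
  finally have "nat ((z + int s) mod int n) = nat (z mod int n) + s"
    using pos by (simp add: nat_add_distrib)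
  then show ?thesis
    using assms by (auto simp: mem_mod_def defect_code_def)
qed

text \<open>A step of \<open>q\<close> keeps the offset and flips the parity of the block, so it
  flips \<open>defect\<close>.\<close>

lemma defect_code_cover:
  assumes "0 < q" "q < n"
  shows "mem_mod n (defect_code n q) z \<or> mem_mod n (defect_code n q) (z + int q)"
proof (rule ccontr)
  assume no: "\<not> ?thesis"
  define x where "x = nat (z mod int n)"
  have "x < n" using assms by (simp add: x_def nat_less_iff)
  then have x: "x < n - q" "defect q x"
    using no not_mem_defect_code[of z n 0 q] unfolding x_def by auto
  then have "defect q (x + q)"
    using no not_mem_defect_code[of z n q q] unfolding x_def by auto
  then show False
    using x(2) assms(1) by (auto simp: defect_def)
qed

text \<open>Every run contains neighbours of opposite status: offsets 0 and 1, offsets 1 and 2, or,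
  when it starts at offset 2 or later, the last offset of one block and the first of the
  next.\<close>

lemma defect_code_hits_run:
  assumes "3 \<le> q" "q < n"
  shows "\<exists>t\<in>{0..<int q}. mem_mod n (defect_code n q) (z + t)"
proof (rule ccontr)
  assume no: "\<not> ?thesis"
  define x where "x = nat (z mod int n)"
  have no': "\<not> mem_mod n (defect_code n q) (z + int t)" if "t < q" for t
    using no that by auto
  have "x < n" using assms by (simp add: x_def nat_less_iff)
  then have "x < n - q"
    using no'[of 0] assms not_mem_defect_code[of z n 0 q] unfolding x_def by auto
  then have def: "defect q (x + t)" if "t < q" for t
    using no'[OF that] that assms not_mem_defect_code[of z n t q] unfolding x_def by auto
  define i s where "i = x div q" and "s = x mod q"
  have x: "x = i * q + s" and s: "s < q"
    using assms by (simp_all add: i_def s_def)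
  consider "s = 0" | "s = 1" | "2 \<le> s" by linarith
  then show False
  proof cases
    case 1
    then show False
      using def[of 0] def[of 1] defect_block[of 0 q i] defect_block[of 1 q i] x assms by simp
  next
    case 2
    then show False
      using def[of 0] def[of 1] defect_block[of 1 q i] defect_block[of 2 q i] x assms by simp
  next
    case 3
    have "x + (q - 1 - s) = i * q + (q - 1)" "x + (q - s) = Suc i * q + 0"
      using x s by simp_all
    then show False
      using def[of "q - 1 - s"] def[of "q - s"] defect_block[of "q - 1" q i]
        defect_block[of 0 q "Suc i"] assms 3 s by (simp del: mult_Suc)
  qed
qed

subsection \<open>The minimum\<close>

lemma min_identifying_code_eqI:
  assumes "identifying_code G r D" "finite D" "card D = c"
    and "\<And>D. identifying_code G r D \<Longrightarrow> finite D \<Longrightarrow> c \<le> card D"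
  shows "min_identifying_code r G = enat c"
  unfolding min_identifying_code_def
proof (rule antisym)
  show "(INF D\<in>{D. finite D \<and> identifying_code G r D}. enat (card D)) \<le> enat c"
    using assms(1-3) by (intro INF_lower2[of D]) auto
  show "enat c \<le> (INF D\<in>{D. finite D \<and> identifying_code G r D}. enat (card D))"
    using assms(4) by (intro INF_greatest) auto
qed

theorem theorem7:
  fixes r k q l m :: nat
  assumes "r \<ge> 1"
    and "2 * r + 5 \<le> 2 * k + 1"
    and "2 * k + 1 \<le> 3 * r + 1"
    and "q = 2 * k - 2 * r"
    and "2 * k + 1 = l * q + m"
    and "l \<ge> 3"
    and "m \<in> {0..q - 1}"
  shows "((odd l \<and> m = q - 1 \<and> 2 * k + 1 \<ge> 5 * q) \<or> (even l \<and> m = 1) \<longrightarrow>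
            min_identifying_code r (cycle_graph (2 * k + 1)) = enat (k + 2)) \<and>
         (\<not> ((odd l \<and> m = q - 1 \<and> 2 * k + 1 \<ge> 5 * q) \<or> (even l \<and> m = 1)) \<longrightarrow>
            min_identifying_code r (cycle_graph (2 * k + 1)) =
              enat (gcd q (2 * k + 1) *
                nat \<lceil>real (2 * k + 1) / real (2 * gcd q (2 * k + 1))\<rceil>))"
proof -
  define n where "n = 2 * k + 1"
  define g where "g = gcd q n"
  \<comment> \<open>The lower bound on \<open>2 * k + 1\<close> gives \<open>4 \<le> q\<close>, the
    upper one \<open>q \<le> r\<close>; then \<open>n\<close> is at least
    \<open>3 * q + 1\<close>.\<close>
  have n: "n = 2 * r + 1 + q" and q: "4 \<le> q" "even q" "q \<le> r" "2 * q < n"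
    using assms by (auto simp: n_def)
  have "odd n" by (simp add: n_def)
  have "g dvd n" by (simp add: g_def)
  then obtain n' where n': "n = g * n'" by (elim dvdE)
  then have "odd g" "odd n'"
    using \<open>odd n\<close> by auto
  then obtain h where h: "n' = 2 * h + 1"
    by (elim oddE)
  interpret cycle_steps n q g h
    by standard (use n' h n in \<open>auto simp: g_def\<close>)
  have q1: "1 \<le> q" and q2: "2 * q \<le> n" using q by auto
  note codeI = identifying_code_cycleI[OF n q1 q2 q(3)]
  note codeD = identifying_code_cycleD[OF n q1 q(4)]
  have fin: "finite D" if "D \<subseteq> {..<n}" for D
    using that by (rule finite_subset) simp
  let ?inverse = "\<lambda>u::int. even u \<and> [u * int q = 1] (mod int n) \<and> (int q - 1) * \<bar>u\<bar> \<le> int n - 5"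
  let ?exc = "(odd l \<and> m = q - 1 \<and> n \<ge> 5 * q) \<or> (even l \<and> m = 1)"
  have exc: "(\<exists>u. ?inverse u) \<longleftrightarrow> ?exc"
    using assms q \<open>odd n\<close> by (intro even_inverse_iff) (auto simp: n_def)
  have lower: "g * (h + 1) \<le> card D" if "identifying_code (cycle_graph n) r D" for D
    using codeD[OF that] by (intro card_cover_ge) auto
  have 1: "min_identifying_code r (cycle_graph n) = enat (k + 2)" if "?exc"
  proof (rule min_identifying_code_eqI)
    from iffD2[OF exc that] obtain u where "?inverse u" ..
    then have u: "even u" "[u * int q = 1] (mod int n)" "(int q - 1) * \<bar>u\<bar> \<le> int n - 5"
      by simp_all
    have "g = 1"
    proof -
      have "int g dvd u * int q - 1"
        using u(2) \<open>g dvd n\<close> by (meson cong_iff_dvd_diff dvd_trans int_dvd_int_iff)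
      moreover have "int g dvd u * int q"
        by (simp add: g_def)
      ultimately have "int g dvd 1"
        by (metis dvd_diff_right_iff)
      then show ?thesis by simp
    qed
    then have hk: "h = k"
      using n' h by (simp add: n_def)
    \<comment> \<open>A smaller code would be a minimum cover with \<open>h + 1 = k + 1\<close>
      vertices and hence miss two arcs.\<close>
    show "k + 2 \<le> card D" if D: "identifying_code (cycle_graph n) r D" "finite D" for D
    proof (rule ccontr)
      assume "\<not> k + 2 \<le> card D"
      then have "card D = h + 1"
        using lower[OF D(1)] hk \<open>g = 1\<close> by simp
      from minimum_cover_two_runs[OF \<open>g = 1\<close> u codeD(1)[OF D(1)] this q1 codeD(2)[OF D(1)]]
      obtain z w where "\<not> [z = w] (mod int n)"
        "\<And>t. t \<in> {0..<int q} \<Longrightarrow> \<not> mem_mod n D (z + t)"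
        "\<And>t. t \<in> {0..<int q} \<Longrightarrow> \<not> mem_mod n D (w + t)"
        by blast
      then show False
        using codeD(3)[OF D(1)] by blast
    qed
    show "identifying_code (cycle_graph n) r (defect_code n q)"
      using defect_code_cover[of q n] defect_code_hits_run[of q n] q
      by (intro codeI) (auto simp: defect_code_def)
    show "finite (defect_code n q)"
      by (simp add: defect_code_def)
    \<comment> \<open>In the first case \<open>n + 1 = (l + 1) * q\<close> with \<open>l + 1\<close>
      even, in the second \<open>n - 1 = l * q\<close> with \<open>l\<close> even.\<close>
    have "\<exists>j\<ge>1. 2 * k + 1 = 2 * j * q + 1 \<or> 2 * k + 2 = 2 * j * q"
      using that
    proof
      assume *: "odd l \<and> m = q - 1 \<and> n \<ge> 5 * q"
      then obtain j where "l = 2 * j + 1" by (auto elim: oddE)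
      then show ?thesis
        using assms(5) * q by (intro exI[of _ "j + 1"]) (auto simp: algebra_simps)
    next
      assume *: "even l \<and> m = 1"
      then obtain j where "l = 2 * j" by (auto elim: evenE)
      then show ?thesis
        using assms(5,6) * q by (intro exI[of _ j]) auto
    qed
    then obtain j where j: "1 \<le> j" "2 * k + 1 = 2 * j * q + 1 \<or> 2 * k + 2 = 2 * j * q"
      by blast
    show "card (defect_code n q) = k + 2"
      unfolding n_def by (rule card_defect_code[OF _ j]) (use q in simp)
  qed
  have 2: "min_identifying_code r (cycle_graph n) = enat (g * (h + 1))" if "\<not> ?exc"
  proof (rule min_identifying_code_eqI)
    show sub: "finite parity_code"
      by (simp add: parity_code_def)
    show "card parity_code = g * (h + 1)"
      by (rule card_parity_code)
    show "g * (h + 1) \<le> card D" if "identifying_code (cycle_graph n) r D" for D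
      using that by (rule lower)
    have runs: "\<exists>t\<in>{0..<int q}. mem_mod n parity_code (z + t) \<or> mem_mod n parity_code (w + t)"
      if ne: "\<not> [z = w] (mod int n)" for z w
    proof (cases "g = 1")
      case True
      show ?thesis
      proof (rule ccontr)
        assume no: "\<not> ?thesis"
        have miss: "\<not> mem_mod n parity_code (z + t)" "\<not> mem_mod n parity_code (w + t)"
          if "t \<in> {0..<int q}" for t
          using no that by blast+
        have "2 \<le> q" using q(1) by simp
        obtain u where "even u" "[u * int q = 1] (mod int n)" "(int q - 1) * \<bar>u\<bar> \<le> int n - 5"
          using miss by (rule parity_code_two_runsD[OF True \<open>2 \<le> q\<close> ne])
        then have "?inverse u"
          by (intro conjI)
        then have "\<exists>u. ?inverse u" ..
        with exc have ?exc by (rule iffD1)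
        with \<open>\<not> ?exc\<close> show False ..
      qed
    next
      case False
      then have "2 \<le> g" using g_pos by simp
      moreover have "g < q"
      proof -
        have "g \<le> q" using q by (auto simp: g_def intro: dvd_imp_le)
        moreover have "g \<noteq> q" using \<open>odd g\<close> \<open>even q\<close> by auto
        ultimately show ?thesis by simp
      qed
      ultimately show ?thesis
        using parity_code_hits_run by blast
    qed
    show "identifying_code (cycle_graph n) r parity_code"
      using parity_code_cover runs by (intro codeI) (auto simp: parity_code_def)
  qed
  \<comment> \<open>As \<open>n = g * (2 * h + 1)\<close>, the ceiling in the formula is
    \<open>h + 1\<close>.\<close>
  have "real n / real (2 * g) = real h + 1 / 2"
    using g_pos n' h by (simp add: field_simps)
  then have "\<lceil>real n / real (2 * g)\<rceil> = int h + 1"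
    by (simp add: ceiling_eq_iff)
  then have "nat \<lceil>real n / real (2 * g)\<rceil> = h + 1"
    by simp
  then show ?thesis
    using 1 2 unfolding n_def[symmetric] g_def[symmetric] by simp
qed

end
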